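(* Let $P=(S^2\times S^2)/\sim$, where $(u,v)\sim(-u,-v)$, and let $p:P\to\mathbb{R}\mathrm{P}^2$ be the map induced by the projection on the first factor. There exists a homeomorphism $\zeta:\mathrm{Gr}_2(\mathbb{R}^4)\to P$ such that $p\circ\zeta=\nu_4$, and $\nu_4:\mathrm{Gr}_2(\mathbb{R}^4)\to\mathbb{R}\mathrm{P}^2$ is a sphere bundle with fibre $S^2$.
   Context: $\mathrm{Gr}_2(\mathbb{R}^4)$ is the real Grassmannian of $2$-dimensional linear subspaces of $\mathbb{R}^4$; $\langle x,y\rangle$ is the plane spanned by linearly independent $x,y$. Let $\mathbb{H}\cong\mathbb{R}^4$ be the quaternions, with conjugation $x\mapsto\bar x$; the pure quaternions ($\bar u=-u$) are identified with $\mathbb{R}^3$. The map $\nu_4:\mathrm{Gr}_2(\mathbb{R}^4)\to\mathbb{R}\mathrm{P}^2$ is $\nu_4(\langle x,y\rangle)=[\frac12(y\bar x-x\bar y)]$ for $x,y\in\mathbb{H}$, where $[u]$ is the class of the nonzero pure quaternion $u$ in $\mathbb{R}\mathrm{P}^2=(\mathbb{R}^3\setminus\{0\})/(u\sim\lambda u,\ \lambda\in\mathbb{R}\setminus\{0\})$. It is well defined and continuous. *)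

theory Defs
  imports "HOL-Analysis.Analysis"
begin

section \<open>Quotient topologies\<close>

text \<open>The finest topology on the image \<open>f ` topspace X\<close> making \<open>f\<close> continuous.\<close>

definition quotient_topology :: "'a topology \<Rightarrow> ('a \<Rightarrow> 'b) \<Rightarrow> 'b topology" where
  "quotient_topology X f =
     topology (\<lambda>U. U \<subseteq> f ` topspace X \<and> openin X {x \<in> topspace X. f x \<in> U})"

lemma openin_quotient_topology:
  "openin (quotient_topology X f) U \<longleftrightarrow>
     U \<subseteq> f ` topspace X \<and> openin X {x \<in> topspace X. f x \<in> U}"
proof -
  have "istopology (\<lambda>U. U \<subseteq> f ` topspace X \<and> openin X {x \<in> topspace X. f x \<in> U})"
    unfolding istopology_def
  proof (intro conjI allI impI)
    fix S T
    assume S: "S \<subseteq> f ` topspace X \<and> openin X {x \<in> topspace X. f x \<in> S}"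
      and T: "T \<subseteq> f ` topspace X \<and> openin X {x \<in> topspace X. f x \<in> T}"
    show "S \<inter> T \<subseteq> f ` topspace X" using S by blast
    have "{x \<in> topspace X. f x \<in> S \<inter> T} =
        {x \<in> topspace X. f x \<in> S} \<inter> {x \<in> topspace X. f x \<in> T}" by blast
    then show "openin X {x \<in> topspace X. f x \<in> S \<inter> T}" using S T by (simp add: openin_Int)
  next
    fix \<K>
    assume K: "\<forall>K\<in>\<K>. K \<subseteq> f ` topspace X \<and> openin X {x \<in> topspace X. f x \<in> K}"
    show "\<Union> \<K> \<subseteq> f ` topspace X" using K by blast
    have "{x \<in> topspace X. f x \<in> \<Union> \<K>} = (\<Union>K\<in>\<K>. {x \<in> topspace X. f x \<in> K})" by blast
    then show "openin X {x \<in> topspace X. f x \<in> \<Union> \<K>}" using K by auto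
  qed
  then show ?thesis
    unfolding quotient_topology_def by (simp add: topology_inverse')
qed

lemma topspace_quotient_topology [simp]:
  "topspace (quotient_topology X f) = f ` topspace X"
proof
  show "topspace (quotient_topology X f) \<subseteq> f ` topspace X"
    using openin_quotient_topology openin_topspace by metis
  have "{x \<in> topspace X. f x \<in> f ` topspace X} = topspace X" by blast
  then have "openin (quotient_topology X f) (f ` topspace X)"
    by (simp add: openin_quotient_topology)
  then show "f ` topspace X \<subseteq> topspace (quotient_topology X f)"
    by (rule openin_subset)
qed

lemma quotient_map_quotient_topology: "quotient_map X (quotient_topology X f) f"
  by (auto simp: quotient_map_def openin_quotient_topology)

section \<open>Fibre bundles\<close>

text \<open>A continuous map \<open>\<pi>\<close> from \<open>E\<close> to \<open>B\<close> that is locally over \<open>B\<close> the projection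
  \<open>U \<times> F \<rightarrow> U\<close>. A sphere bundle is a fibre bundle whose fibre \<open>F\<close> is a sphere.\<close>

definition fibre_bundle ::
    "'e topology \<Rightarrow> 'b topology \<Rightarrow> 'f topology \<Rightarrow> ('e \<Rightarrow> 'b) \<Rightarrow> bool" where
  "fibre_bundle E B F \<pi> \<longleftrightarrow>
     continuous_map E B \<pi> \<and>
     (\<forall>b \<in> topspace B. \<exists>U \<phi>. openin B U \<and> b \<in> U \<and>
        homeomorphic_map (subtopology E {e \<in> topspace E. \<pi> e \<in> U})
                         (prod_topology (subtopology B U) F) \<phi> \<and>
        (\<forall>e \<in> topspace E. \<pi> e \<in> U \<longrightarrow> fst (\<phi> e) = \<pi> e))"

section \<open>Quaternions\<close>

text \<open>The vector \<open>x\<close> in \<open>\<real>\<^sup>4\<close> stands for the quaternion \<open>x\<^sub>1 + x\<^sub>2 i + x\<^sub>3 j + x\<^sub>4 k\<close>.\<close>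

definition qmult :: "real^4 \<Rightarrow> real^4 \<Rightarrow> real^4"  (infixl "\<odot>" 70) where
  "x \<odot> y = vector
     [x$1 * y$1 - x$2 * y$2 - x$3 * y$3 - x$4 * y$4,
      x$1 * y$2 + x$2 * y$1 + x$3 * y$4 - x$4 * y$3,
      x$1 * y$3 - x$2 * y$4 + x$3 * y$1 + x$4 * y$2,
      x$1 * y$4 + x$2 * y$3 - x$3 * y$2 + x$4 * y$1]"

definition qcnj :: "real^4 \<Rightarrow> real^4" where
  "qcnj x = vector [x$1, - x$2, - x$3, - x$4]"

definition pure_quat :: "real^4 \<Rightarrow> bool" where
  "pure_quat u \<longleftrightarrow> qcnj u = - u"

text \<open>On pure quaternions this is the identification with \<open>\<real>\<^sup>3\<close>.\<close>

definition vec_part :: "real^4 \<Rightarrow> real^3" where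
  "vec_part u = vector [u$2, u$3, u$4]"

lemma vector_4_nth [simp]:
  "(vector [a, b, c, d] :: 'a::zero^4) $ 1 = a"
  "(vector [a, b, c, d] :: 'a::zero^4) $ 2 = b"
  "(vector [a, b, c, d] :: 'a::zero^4) $ 3 = c"
  "(vector [a, b, c, d] :: 'a::zero^4) $ 4 = d"
  unfolding vector_def by simp_all

lemma bij_betw_vec_part: "bij_betw vec_part {u. pure_quat u} UNIV"
proof (rule bij_betwI[where g = "\<lambda>w. vector [0, w$1, w$2, w$3]"])
  show "(\<lambda>w::real^3. vector [0, w$1, w$2, w$3]) \<in> UNIV \<rightarrow> {u. pure_quat u}"
    by (simp add: pure_quat_def qcnj_def vec_eq_iff forall_4)
qed (auto simp: pure_quat_def qcnj_def vec_part_def vec_eq_iff forall_4 forall_3)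

section \<open>The spaces and maps\<close>

definition lin_indep_pairs :: "((real^4) \<times> (real^4)) set" where
  "lin_indep_pairs = {(x, y). x \<noteq> y \<and> independent {x, y}}"

definition Gr24 :: "(real^4) set topology" where
  "Gr24 = quotient_topology (top_of_set lin_indep_pairs) (\<lambda>(x, y). span {x, y})"

definition scale_rel :: "((real^3) \<times> (real^3)) set" where
  "scale_rel = {(u, w). u \<noteq> 0 \<and> w \<noteq> 0 \<and> (\<exists>c. c \<noteq> 0 \<and> w = c *\<^sub>R u)}"

definition proj_class :: "real^3 \<Rightarrow> (real^3) set" where
  "proj_class u = scale_rel `` {u}"

definition RP2 :: "(real^3) set topology" where
  "RP2 = quotient_topology (top_of_set (- {0})) proj_class"

abbreviation S2 :: "(real^3) set" where
  "S2 \<equiv> sphere 0 1"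

definition antipodal_rel :: "(((real^3) \<times> (real^3)) \<times> ((real^3) \<times> (real^3))) set" where
  "antipodal_rel =
     {((u, v), (u', v')). u \<in> S2 \<and> v \<in> S2 \<and> ((u', v') = (u, v) \<or> (u', v') = (- u, - v))}"

definition P_space :: "((real^3) \<times> (real^3)) set topology" where
  "P_space = quotient_topology (prod_topology (top_of_set S2) (top_of_set S2))
                               (\<lambda>z. antipodal_rel `` {z})"

text \<open>In the next two definitions the class does not depend on the chosen representative:
  see \<open>P_proj_class\<close> and \<open>nu4_span\<close> below.\<close>

definition P_proj :: "((real^3) \<times> (real^3)) set \<Rightarrow> (real^3) set" where
  "P_proj C = (THE l. \<exists>u v. (u, v) \<in> C \<and> l = proj_class u)"

definition nu4 :: "(real^4) set \<Rightarrow> (real^3) set" where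
  "nu4 V = (THE l. \<exists>x y. (x, y) \<in> lin_indep_pairs \<and> V = span {x, y} \<and>
     l = proj_class (vec_part ((1/2) *\<^sub>R (y \<odot> qcnj x - x \<odot> qcnj y))))"

section \<open>Well-definedness\<close>

lemma equiv_scale_rel: "equiv (- {0}) scale_rel"
proof (rule equivI)
  show "scale_rel \<subseteq> (- {0}) \<times> (- {0})" by (auto simp: scale_rel_def)
  show "refl_on (- {0}) scale_rel"
    by (auto simp: refl_on_def scale_rel_def intro: exI[of _ 1])
  show "sym scale_rel"
  proof (rule symI)
    fix u w assume "(u, w) \<in> scale_rel"
    then obtain c where "u \<noteq> 0" "w \<noteq> 0" "c \<noteq> 0" "w = c *\<^sub>R u" by (auto simp: scale_rel_def)
    then show "(w, u) \<in> scale_rel"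
      by (auto simp: scale_rel_def intro: exI[of _ "inverse c"])
  qed
  show "trans scale_rel"
  proof (rule transI)
    fix u v w assume "(u, v) \<in> scale_rel" "(v, w) \<in> scale_rel"
    then obtain c d where "u \<noteq> 0" "w \<noteq> 0" "c \<noteq> 0" "d \<noteq> 0" "v = c *\<^sub>R u" "w = d *\<^sub>R v"
      by (auto simp: scale_rel_def)
    then show "(u, w) \<in> scale_rel"
      by (auto simp: scale_rel_def intro: exI[of _ "d * c"])
  qed
qed

lemma equiv_antipodal_rel: "equiv (S2 \<times> S2) antipodal_rel"
  by (rule equivI) (auto simp: refl_on_def sym_def trans_def antipodal_rel_def)

lemma topspace_RP2: "topspace RP2 = (- {0}) // scale_rel"
  by (auto simp: RP2_def proj_class_def quotient_def)

lemma topspace_P_space: "topspace P_space = (S2 \<times> S2) // antipodal_rel"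
  by (auto simp: P_space_def quotient_def)

lemma topspace_Gr24: "topspace Gr24 = {V. subspace V \<and> dim V = 2}"
proof
  show "topspace Gr24 \<subseteq> {V. subspace V \<and> dim V = 2}"
    by (auto simp: Gr24_def lin_indep_pairs_def dim_span dim_eq_card_independent)
  show "{V. subspace V \<and> dim V = 2} \<subseteq> topspace Gr24"
  proof
    fix V :: "(real^4) set" assume "V \<in> {V. subspace V \<and> dim V = 2}"
    then have V: "subspace V" "dim V = 2" by auto
    obtain B where B: "B \<subseteq> V" "independent B" "V \<subseteq> span B" "card B = 2"
      using basis_exists[of V] V by metis
    then obtain x y where xy: "B = {x, y}" "x \<noteq> y" by (meson card_2_iff)
    have "V = span {x, y}"
      using B V xy span_minimal by blast
    then have "V = (\<lambda>(x, y). span {x, y}) (x, y)" by simp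
    moreover have "(x, y) \<in> lin_indep_pairs"
      using B xy by (simp add: lin_indep_pairs_def)
    ultimately show "V \<in> topspace Gr24"
      unfolding Gr24_def topspace_quotient_topology topspace_euclidean_subtopology by (rule image_eqI)
  qed
qed

lemma proj_class_scaleR: "c \<noteq> 0 \<Longrightarrow> proj_class (c *\<^sub>R u) = proj_class u"
proof (cases "u = 0")
  case False
  assume "c \<noteq> 0"
  then have "(u, c *\<^sub>R u) \<in> scale_rel" using False by (auto simp: scale_rel_def)
  then show ?thesis
    unfolding proj_class_def using equiv_class_eq[OF equiv_scale_rel] by blast
qed simp

lemma P_proj_class:
  assumes "u \<in> S2" "v \<in> S2"
  shows "P_proj (antipodal_rel `` {(u, v)}) = proj_class u"
proof -
  have "proj_class (- u) = proj_class u" using proj_class_scaleR[of "-1" u] by simp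
  then show ?thesis
    unfolding P_proj_def using assms
    by (intro the_equality) (auto simp: antipodal_rel_def)
qed

lemma pure_nu4_formula: "pure_quat ((1/2) *\<^sub>R (y \<odot> qcnj x - x \<odot> qcnj y))"
  by (simp add: pure_quat_def qmult_def qcnj_def vec_eq_iff forall_4)

lemma nu4_formula_nonzero:
  assumes "(x, y) \<in> lin_indep_pairs"
  shows "vec_part ((1/2) *\<^sub>R (y \<odot> qcnj x - x \<odot> qcnj y)) \<noteq> 0"
proof
  assume "vec_part ((1/2) *\<^sub>R (y \<odot> qcnj x - x \<odot> qcnj y)) = 0"
  then have e: "y$2 * x$1 - y$1 * x$2 - y$3 * x$4 + y$4 * x$3 = 0"
      "y$3 * x$1 - y$1 * x$3 + y$2 * x$4 - y$4 * x$2 = 0"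
      "y$4 * x$1 - y$1 * x$4 - y$2 * x$3 + y$3 * x$2 = 0"
    by (auto simp: vec_part_def qmult_def qcnj_def vec_eq_iff forall_3 algebra_simps)
  define r where "r = x$1 * y$1 + x$2 * y$2 + x$3 * y$3 + x$4 * y$4"
  define n where "n = x$1 * x$1 + x$2 * x$2 + x$3 * x$3 + x$4 * x$4"
  have ny: "n *\<^sub>R y = r *\<^sub>R x"
    unfolding vec_eq_iff forall_4 n_def r_def vector_scaleR_component real_scaleR_def
    using e by (intro conjI; algebra)
  have x0: "x \<noteq> 0"
    using assms dependent_zero by (auto simp: lin_indep_pairs_def)
  have "n = x \<bullet> x" by (simp add: n_def inner_vec_def sum_4)
  then have "n \<noteq> 0" using x0 by simp
  then have "y = (r / n) *\<^sub>R x" using ny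
    by (metis (no_types) divide_inverse_commute scaleR_one scaleR_scaleR left_inverse)
  then have "y \<in> span {x}" by (simp add: span_base span_scale)
  moreover have "y \<notin> span {x}"
    using assms independent_insert[of y "{x}"]
    by (auto simp: lin_indep_pairs_def insert_commute)
  ultimately show False by simp
qed

lemma nu4_span:
  assumes "(x, y) \<in> lin_indep_pairs"
  shows "nu4 (span {x, y}) = proj_class (vec_part ((1/2) *\<^sub>R (y \<odot> qcnj x - x \<odot> qcnj y)))"
    (is "_ = proj_class (?f x y)")
  unfolding nu4_def
proof (rule the_equality)
  show "\<exists>x' y'. (x', y') \<in> lin_indep_pairs \<and> span {x, y} = span {x', y'} \<and>
      proj_class (?f x y) = proj_class (?f x' y')"
    using assms by blast
next
  fix l
  assume "\<exists>x' y'. (x', y') \<in> lin_indep_pairs \<and> span {x, y} = span {x', y'} \<and>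
      l = proj_class (?f x' y')"
  then obtain x' y' where *: "(x', y') \<in> lin_indep_pairs" "span {x, y} = span {x', y'}"
    and l: "l = proj_class (?f x' y')" by blast
  have "x' \<in> span {x, y}" "y' \<in> span {x, y}" unfolding *(2) by (simp_all add: span_base)
  then obtain a b c d where x': "x' = a *\<^sub>R x + b *\<^sub>R y" and y': "y' = c *\<^sub>R x + d *\<^sub>R y"
    unfolding span_insert span_singleton
    by (auto simp: algebra_simps)
  have f: "?f x' y' = (a * d - b * c) *\<^sub>R ?f x y"
    unfolding x' y' by (simp add: vec_part_def qmult_def qcnj_def vec_eq_iff forall_3) algebra
  have "a * d - b * c \<noteq> 0" using nu4_formula_nonzero[OF *(1)] f by auto
  then show "l = proj_class (?f x y)" unfolding l f by (rule proj_class_scaleR)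
qed

end

theory Submission
  imports Defs
begin

text \<open>For linearly independent \<open>x\<close>, \<open>y\<close> let \<open>l\<close> and \<open>r\<close> be the pure quaternions
  \<open>(y x\<^sup>* - x y\<^sup>*)/2\<close> and \<open>(x\<^sup>* y - y\<^sup>* x)/2\<close>, where \<open>\<^sup>*\<close> is conjugation. They have the same norm, a
  change of basis multiplies both by its determinant, and the plane spanned by \<open>x\<close>, \<open>y\<close> is
  recovered as \<open>{z. l z = z r}\<close>. Hence the plane corresponds to the class of the pair of unit vectors
  of \<open>l\<close> and \<open>r\<close> in \<open>P\<close>. Conversely, for unit pure \<open>u\<close>, \<open>v\<close> and a fixed quaternion \<open>a\<close>, the
  quaternion \<open>h = a - u a v\<close> satisfies \<open>u h = h v\<close>, and \<open>(h, u h)\<close> is a basis, depending continuously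
  on \<open>(u, v)\<close> where \<open>h \<noteq> 0\<close>, of the plane belonging to \<open>(u, v)\<close>. These local sections make
  all maps involved quotient maps, so a comparison of fibres yields the homeomorphisms; over the
  lines not orthogonal to \<open>u\<^sub>0\<close>, choosing the representative \<open>u\<close> with \<open>u \<bullet> u\<^sub>0 > 0\<close> trivialises the
  bundle.\<close>


section \<open>Recognising quotient maps and comparing quotients\<close>

lemma quotient_map_local_sections:
  assumes f: "continuous_map X Y f"
    and sec: "\<And>y. y \<in> topspace Y \<Longrightarrow> \<exists>N s. openin Y N \<and> y \<in> N \<and>
      continuous_map (subtopology Y N) X s \<and> (\<forall>z\<in>N. f (s z) = z)"
  shows "quotient_map X Y f"
  unfolding quotient_map_def
proof (intro conjI allI impI)
  show "f ` topspace X = topspace Y"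
  proof
    show "f ` topspace X \<subseteq> topspace Y"
      using f by (rule continuous_map_image_subset_topspace)
    show "topspace Y \<subseteq> f ` topspace X"
    proof
      fix y assume y: "y \<in> topspace Y"
      from sec[OF y] obtain N s where N: "y \<in> N" "continuous_map (subtopology Y N) X s" "f (s y) = y"
        by blast
      then have "s y \<in> topspace X"
        using y by (force simp: continuous_map_def)
      then show "y \<in> f ` topspace X" using N by (metis image_eqI)
    qed
  qed
next
  fix U assume U: "U \<subseteq> topspace Y"
  show "openin X {x \<in> topspace X. f x \<in> U} = openin Y U"
  proof
    assume "openin Y U"
    then show "openin X {x \<in> topspace X. f x \<in> U}" 
      using f by (rule openin_continuous_map_preimage[rotated])
  next
    assume o: "openin X {x \<in> topspace X. f x \<in> U}"
    show "openin Y U"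
    proof (subst openin_subopen, intro ballI)
      fix y assume y: "y \<in> U"
      then have "y \<in> topspace Y" using U by blast
      from sec[OF this] obtain N s where N: "openin Y N" "y \<in> N"
        "continuous_map (subtopology Y N) X s" "\<And>z. z \<in> N \<Longrightarrow> f (s z) = z"
        by blast
      \<comment> \<open>Because \<open>f (s z) = z\<close> on \<open>N\<close>, pulling the open
        preimage of \<open>U\<close> back along \<open>s\<close> gives exactly
        \<open>U \<inter> N\<close>, an open neighbourhood of \<open>y\<close> inside
        \<open>U\<close>.\<close>
      let ?T = "{z \<in> topspace (subtopology Y N). s z \<in> {x \<in> topspace X. f x \<in> U}}"
      have "openin (subtopology Y N) ?T"
        using N(3) o by (rule openin_continuous_map_preimage)
      then have "openin Y ?T"
        using N(1) openin_trans_full by blast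
      moreover have "y \<in> ?T"
        using y N \<open>y \<in> topspace Y\<close> by (force simp: continuous_map_def)
      moreover have "?T \<subseteq> U" using N(4) by auto
      ultimately show "\<exists>T. openin Y T \<and> y \<in> T \<and> T \<subseteq> U" by blast
    qed
  qed
qed

text \<open>The map \<open>r\<close> descends along \<open>q\<close> to a continuous
  \<open>h\<close>. Since \<open>h \<circ> q\<close> agrees with the quotient map \<open>r\<close>,
  so does \<open>h\<close> become a quotient map, and equality of the fibres makes it
  injective.\<close>

lemma homeomorphic_map_quotients:
  assumes q: "quotient_map X A q" and r: "quotient_map X B r"
    and fib: "\<And>x y. x \<in> topspace X \<Longrightarrow> y \<in> topspace X \<Longrightarrow> q x = q y \<longleftrightarrow> r x = r y"
  obtains h where "homeomorphic_map A B h" "\<And>x. x \<in> topspace X \<Longrightarrow> h (q x) = r x"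
proof -
  obtain h where h: "continuous_map A B h" "h ` topspace A = r ` topspace X"
      "\<And>x. x \<in> topspace X \<Longrightarrow> h (q x) = r x"
    using quotient_map_lift_exists[OF q quotient_imp_continuous_map[OF r]] fib by metis
  have "quotient_map X B (h \<circ> q)"
    using r by (rule quotient_map_eq) (simp add: h)
  then have "quotient_map A B h"
    using quotient_map_from_composition quotient_imp_continuous_map[OF q] h(1) by blast
  moreover have "inj_on h (topspace A)"
  proof (rule inj_onI)
    fix a b assume "a \<in> topspace A" "b \<in> topspace A" and e: "h a = h b"
    then obtain x y where "x \<in> topspace X" "a = q x" "y \<in> topspace X" "b = q y"
      unfolding quotient_imp_surjective_map[OF q, symmetric] by blast
    then show "a = b" using e fib h(3) by simp
  qed
  ultimately have "homeomorphic_map A B h"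
    by (simp add: homeomorphic_map_def)
  then show ?thesis using h(3) that by blast
qed

section \<open>Quaternion multiplication and the two vectors attached to a pair\<close>

lemma bounded_bilinear_qmult: "bounded_bilinear (\<odot>)"
  unfolding bilinear_conv_bounded_bilinear[symmetric] bilinear_def
  by (auto intro!: linearI simp: qmult_def vec_eq_iff forall_4 algebra_simps)

interpretation qmult: bounded_bilinear "(\<odot>)"
  by (rule bounded_bilinear_qmult)

lemma qmult_assoc: "(x \<odot> y) \<odot> z = x \<odot> (y \<odot> z)"
  by (simp add: qmult_def vec_eq_iff forall_4 algebra_simps)

text \<open>The inverse of \<open>vec_part\<close> on pure quaternions; it lets vectors of
  \<open>real^3\<close> act on \<open>real^4\<close> from the left and from the right.\<close>

definition imq :: "real^3 \<Rightarrow> real^4" where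
  "imq w = vector [0, w$1, w$2, w$3]"

lemma bounded_linear_imq: "bounded_linear imq"
  unfolding linear_conv_bounded_linear[symmetric]
  by (auto intro!: linearI simp: imq_def vec_eq_iff forall_4)

lemma bounded_linear_vec_part: "bounded_linear vec_part"
  unfolding linear_conv_bounded_linear[symmetric]
  by (auto intro!: linearI simp: vec_part_def vec_eq_iff forall_3)

lemma bounded_linear_qcnj: "bounded_linear qcnj"
  unfolding linear_conv_bounded_linear[symmetric]
  by (auto intro!: linearI simp: qcnj_def vec_eq_iff forall_4)

text \<open>Up to scale, \<open>lvec\<close> and \<open>rvec\<close> are the coordinates of the
  self-dual and anti-self-dual parts of the bivector of \<open>x\<close> and
  \<open>y\<close>.\<close>

definition lvec :: "real^4 \<Rightarrow> real^4 \<Rightarrow> real^3" where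
  "lvec x y = vec_part ((1/2) *\<^sub>R (y \<odot> qcnj x - x \<odot> qcnj y))"

definition rvec :: "real^4 \<Rightarrow> real^4 \<Rightarrow> real^3" where
  "rvec x y = vec_part ((1/2) *\<^sub>R (qcnj x \<odot> y - qcnj y \<odot> x))"

lemma continuous_on_lvec [continuous_intros]:
  "continuous_on S f \<Longrightarrow> continuous_on S g \<Longrightarrow> continuous_on S (\<lambda>z. lvec (f z) (g z))"
  unfolding lvec_def
  by (intro continuous_intros bounded_linear.continuous_on[OF bounded_linear_vec_part]
      bounded_linear.continuous_on[OF bounded_linear_qcnj] qmult.continuous_on)

lemma continuous_on_rvec [continuous_intros]:
  "continuous_on S f \<Longrightarrow> continuous_on S g \<Longrightarrow> continuous_on S (\<lambda>z. rvec (f z) (g z))"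
  unfolding rvec_def
  by (intro continuous_intros bounded_linear.continuous_on[OF bounded_linear_vec_part]
      bounded_linear.continuous_on[OF bounded_linear_qcnj] qmult.continuous_on)

text \<open>An alternating bilinear map sees a change of basis only through its determinant. The
  factor is the same for \<open>rvec\<close>, so the pair of vectors up to a common scalar depends
  on the plane alone.\<close>

lemma lvec_combination:
  "lvec (a *\<^sub>R x + b *\<^sub>R y) (c *\<^sub>R x + d *\<^sub>R y) = (a * d - b * c) *\<^sub>R lvec x y"
  by (simp add: lvec_def vec_part_def qmult_def qcnj_def vec_eq_iff forall_3) algebra

lemma rvec_combination:
  "rvec (a *\<^sub>R x + b *\<^sub>R y) (c *\<^sub>R x + d *\<^sub>R y) = (a * d - b * c) *\<^sub>R rvec x y"
  by (simp add: rvec_def vec_part_def qmult_def qcnj_def vec_eq_iff forall_3) algebra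

text \<open>The right-hand side is the Gram determinant of \<open>x\<close> and \<open>y\<close>. As
  \<open>rvec\<close> gives the same value, the two vectors have equal length.\<close>

lemma lvec_inner_self: "lvec x y \<bullet> lvec x y = (x \<bullet> x) * (y \<bullet> y) - (x \<bullet> y)\<^sup>2"
  by (simp add: lvec_def vec_part_def qmult_def qcnj_def inner_vec_def sum_4 sum_3) algebra

lemma rvec_inner_self: "rvec x y \<bullet> rvec x y = (x \<bullet> x) * (y \<bullet> y) - (x \<bullet> y)\<^sup>2"
  by (simp add: rvec_def vec_part_def qmult_def qcnj_def inner_vec_def sum_4 sum_3) algebra

lemma norm_rvec: "norm (rvec x y) = norm (lvec x y)"
  by (simp add: norm_eq_sqrt_inner lvec_inner_self rvec_inner_self)

lemma lvec_nonzero: "(x, y) \<in> lin_indep_pairs \<Longrightarrow> lvec x y \<noteq> 0"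
  unfolding lvec_def by (rule nu4_formula_nonzero)

lemma rvec_nonzero: "(x, y) \<in> lin_indep_pairs \<Longrightarrow> rvec x y \<noteq> 0"
  using lvec_nonzero norm_rvec by (metis norm_eq_zero)

text \<open>A dependent pair has \<open>x = 0\<close> or \<open>y = k *\<^sub>R x\<close>, and in
  both cases a coefficient matrix of determinant 0 kills \<open>lvec\<close>. This is how the local
  sections are seen to consist of bases.\<close>

lemma lin_indep_pairs_if_lvec_nonzero: "lvec x y \<noteq> 0 \<Longrightarrow> (x, y) \<in> lin_indep_pairs"
proof (rule ccontr)
  assume l: "lvec x y \<noteq> 0" and "(x, y) \<notin> lin_indep_pairs"
  then have "dependent {x, y} \<or> x = y" by (auto simp: lin_indep_pairs_def)
  then have "x = 0 \<or> y \<in> span {x}"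
    using independent_insert[of y "{x}"] by (auto simp: insert_commute span_base split: if_splits)
  then obtain k where "x = 0 \<or> y = k *\<^sub>R x"
    by (auto simp: span_singleton)
  then have "lvec x y = 0"
    using lvec_combination[of 1 x 0 x k 0] lvec_combination[of 0 0 0 y 0 1] by auto
  with l show False by simp
qed

text \<open>The imaginary part of \<open>y \<odot> qcnj x\<close> is that product minus its real
  part \<open>x \<bullet> y\<close>, and \<open>qcnj x \<odot> x\<close> is the real number
  \<open>x \<bullet> x\<close>. With the three companions below, left multiplication by
  \<open>lvec x y\<close> and right multiplication by \<open>rvec x y\<close> agree on
  \<open>x\<close> and on \<open>y\<close>.\<close>

lemma lvec_qmult_left: "imq (lvec x y) \<odot> x = (x \<bullet> x) *\<^sub>R y - (x \<bullet> y) *\<^sub>R x"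
  by (simp add: imq_def lvec_def vec_part_def qmult_def qcnj_def vec_eq_iff forall_4
      inner_vec_def sum_4 algebra_simps)

lemma rvec_qmult_left: "x \<odot> imq (rvec x y) = (x \<bullet> x) *\<^sub>R y - (x \<bullet> y) *\<^sub>R x"
  by (simp add: imq_def rvec_def vec_part_def qmult_def qcnj_def vec_eq_iff forall_4
      inner_vec_def sum_4 algebra_simps)

lemma lvec_qmult_right: "imq (lvec x y) \<odot> y = (x \<bullet> y) *\<^sub>R y - (y \<bullet> y) *\<^sub>R x"
  by (simp add: imq_def lvec_def vec_part_def qmult_def qcnj_def vec_eq_iff forall_4
      inner_vec_def sum_4 algebra_simps)

lemma rvec_qmult_right: "y \<odot> imq (rvec x y) = (x \<bullet> y) *\<^sub>R y - (y \<bullet> y) *\<^sub>R x"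
  by (simp add: imq_def rvec_def vec_part_def qmult_def qcnj_def vec_eq_iff forall_4
      inner_vec_def sum_4 algebra_simps)

text \<open>This is the conjugate of
  \<open>imq (lvec x y) \<odot> x = x \<odot> imq (rvec x y)\<close>: conjugation reverses products
  and negates both pure factors.\<close>

lemma rvec_qmult_cnj: "imq (rvec x y) \<odot> qcnj x = qcnj x \<odot> imq (lvec x y)"
  by (simp add: imq_def lvec_def rvec_def vec_part_def qmult_def qcnj_def vec_eq_iff forall_4
      algebra_simps)

text \<open>Commuting with \<open>imq l\<close> makes the cross product of \<open>l\<close> and
  \<open>vec_part w\<close> vanish, so for \<open>l \<noteq> 0\<close> the quaternion
  \<open>w\<close> is a combination of 1 and \<open>imq l\<close>. The factor
  \<open>l \<bullet> l\<close> avoids a division.\<close>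

lemma commuting_with_imq:
  assumes "imq l \<odot> w = w \<odot> imq l"
  shows "(l \<bullet> l) *\<^sub>R w \<odot> x = (l \<bullet> l) *\<^sub>R (w$1) *\<^sub>R x + (l \<bullet> vec_part w) *\<^sub>R (imq l \<odot> x)"
proof -
  from assms have e: "l$2 * w$4 = l$3 * w$3" "l$3 * w$2 = l$1 * w$4" "l$1 * w$3 = l$2 * w$2"
    by (auto simp: imq_def qmult_def vec_eq_iff forall_4 algebra_simps)
  have "(l \<bullet> l) *\<^sub>R w = ((l \<bullet> l) * w$1) *\<^sub>R vector [1,0,0,0] + (l \<bullet> vec_part w) *\<^sub>R imq l"
    unfolding vec_eq_iff forall_4 imq_def vec_part_def inner_vec_def sum_3
    using e by (simp; intro conjI; algebra)
  moreover have "vector [1,0,0,0] \<odot> x = x"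
    by (simp add: vec_eq_iff forall_4 qmult_def)
  ultimately show ?thesis
    by (simp add: qmult.add_left qmult.scaleR_left)
qed

section \<open>Recovering a plane from its two vectors\<close>

lemma span_eq_eigenspace:
  assumes "(x, y) \<in> lin_indep_pairs"
  shows "span {x, y} = {z. imq (lvec x y) \<odot> z = z \<odot> imq (rvec x y)}"
proof (intro equalityI subsetI)
  fix z assume "z \<in> span {x, y}"
  then obtain a b where z: "z = a *\<^sub>R x + b *\<^sub>R y"
    unfolding span_insert span_singleton by (auto simp: algebra_simps)
  show "z \<in> {z. imq (lvec x y) \<odot> z = z \<odot> imq (rvec x y)}"
    by (simp add: z qmult.add_right qmult.add_left qmult.scaleR_left qmult.scaleR_right
        lvec_qmult_left rvec_qmult_left lvec_qmult_right rvec_qmult_right)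
next
  fix z assume "z \<in> {z. imq (lvec x y) \<odot> z = z \<odot> imq (rvec x y)}"
  then have z: "imq (lvec x y) \<odot> z = z \<odot> imq (rvec x y)" by simp
  \<comment> \<open>Moving \<open>imq (lvec x y)\<close> past \<open>z\<close> and then past
    \<open>qcnj x\<close> shows that it commutes with \<open>w\<close>. Hence a nonzero multiple of
    \<open>w \<odot> x\<close> is a combination of \<open>x\<close> and
    \<open>imq (lvec x y) \<odot> x\<close>, both in the plane, while \<open>w \<odot> x\<close> is
    itself a nonzero multiple of \<open>z\<close>.\<close>
  define w where "w = z \<odot> qcnj x"
  have "imq (lvec x y) \<odot> w = w \<odot> imq (lvec x y)"
    unfolding w_def qmult_assoc rvec_qmult_cnj[symmetric]
    by (simp add: qmult_assoc[symmetric] z)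
  from commuting_with_imq[OF this, of x]
  have "(lvec x y \<bullet> lvec x y) *\<^sub>R (w \<odot> x) \<in> span {x, y}"
    by (simp add: lvec_qmult_left qmult.scaleR_left span_add span_scale span_diff span_base
        del: scaleR_scaleR)
  moreover have "w \<odot> x = (x \<bullet> x) *\<^sub>R z"
    by (simp add: w_def qmult_def qcnj_def vec_eq_iff forall_4 inner_vec_def sum_4 algebra_simps)
  moreover have "x \<noteq> 0"
    using assms dependent_zero by (auto simp: lin_indep_pairs_def)
  moreover define k where "k = (lvec x y \<bullet> lvec x y) * (x \<bullet> x)"
  ultimately have "k *\<^sub>R z \<in> span {x, y}" "k \<noteq> 0"
    using lvec_nonzero[OF assms] by simp_all
  then show "z \<in> span {x, y}"
    using span_scale[of "k *\<^sub>R z" "{x, y}" "1 / k"] by simp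
qed

text \<open>A change of basis multiplies both vectors by its determinant; conversely a common
  nonzero factor cancels from the equation of the eigenspace.\<close>

lemma span_eq_iff_vecs:
  assumes "(x, y) \<in> lin_indep_pairs" "(x', y') \<in> lin_indep_pairs"
  shows "span {x, y} = span {x', y'} \<longleftrightarrow>
    (\<exists>c. c \<noteq> 0 \<and> lvec x' y' = c *\<^sub>R lvec x y \<and> rvec x' y' = c *\<^sub>R rvec x y)"
proof
  assume e: "span {x, y} = span {x', y'}"
  have "x' \<in> span {x, y}" "y' \<in> span {x, y}" unfolding e by (simp_all add: span_base)
  then obtain a b c d where x': "x' = a *\<^sub>R x + b *\<^sub>R y" and y': "y' = c *\<^sub>R x + d *\<^sub>R y"
    unfolding span_insert span_singleton by (auto simp: algebra_simps)
  have "lvec x' y' = (a * d - b * c) *\<^sub>R lvec x y" "rvec x' y' = (a * d - b * c) *\<^sub>R rvec x y"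
    unfolding x' y' by (rule lvec_combination rvec_combination)+
  moreover from this have "a * d - b * c \<noteq> 0" using lvec_nonzero[OF assms(2)] by auto
  ultimately show "\<exists>c. c \<noteq> 0 \<and> lvec x' y' = c *\<^sub>R lvec x y \<and> rvec x' y' = c *\<^sub>R rvec x y"
    by blast
next
  assume "\<exists>c. c \<noteq> 0 \<and> lvec x' y' = c *\<^sub>R lvec x y \<and> rvec x' y' = c *\<^sub>R rvec x y"
  then show "span {x, y} = span {x', y'}"
    unfolding span_eq_eigenspace[OF assms(1)] span_eq_eigenspace[OF assms(2)]
    by (auto simp: linear_cmul[OF bounded_linear.linear[OF bounded_linear_imq]]
        qmult.scaleR_left qmult.scaleR_right)
qed

section \<open>Unit vectors of a pair and local sections\<close>

definition unit_vecs :: "(real^4) \<times> (real^4) \<Rightarrow> (real^3) \<times> (real^3)" where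
  "unit_vecs = (\<lambda>(x, y). (sgn (lvec x y), sgn (rvec x y)))"

text \<open>For unit \<open>u\<close> and \<open>v\<close> the map sending \<open>a\<close> to
  \<open>- (imq u \<odot> a \<odot> imq v)\<close> is an involution, so this is twice the projection
  of \<open>a\<close> onto its fixed space, where
  \<open>imq u \<odot> h = h \<odot> imq v\<close>.\<close>

definition intertwiner :: "real^4 \<Rightarrow> (real^3) \<times> (real^3) \<Rightarrow> real^4" where
  "intertwiner a = (\<lambda>(u, v). a - imq u \<odot> a \<odot> imq v)"

lemma continuous_on_intertwiner: "continuous_on S (intertwiner a)"
  unfolding intertwiner_def case_prod_unfold
  by (intro continuous_intros bounded_linear.continuous_on[OF bounded_linear_imq] qmult.continuous_on)

lemma imq_square: "norm u = 1 \<Longrightarrow> imq u \<odot> (imq u \<odot> x) = - x"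
proof -
  assume "norm u = 1"
  then have "u \<bullet> u = 1" by (simp add: norm_eq_sqrt_inner)
  moreover have "imq u \<odot> (imq u \<odot> x) = - ((u \<bullet> u) *\<^sub>R x)"
    by (simp add: imq_def qmult_def vec_eq_iff forall_4 inner_vec_def sum_3 algebra_simps)
  ultimately show ?thesis by simp
qed

lemma imq_square_right: "norm u = 1 \<Longrightarrow> x \<odot> imq u \<odot> imq u = - x"
proof -
  assume "norm u = 1"
  then have "u \<bullet> u = 1" by (simp add: norm_eq_sqrt_inner)
  moreover have "x \<odot> imq u \<odot> imq u = - ((u \<bullet> u) *\<^sub>R x)"
    by (simp add: imq_def qmult_def vec_eq_iff forall_4 inner_vec_def sum_3 algebra_simps)
  ultimately show ?thesis by simp
qed

lemma intertwiner_intertwines: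
  assumes "norm u = 1" "norm v = 1"
  shows "imq u \<odot> intertwiner a (u, v) = intertwiner a (u, v) \<odot> imq v"
proof -
  have "imq u \<odot> (imq u \<odot> a \<odot> imq v) = - (a \<odot> imq v)"
    using imq_square[OF assms(1), of "a \<odot> imq v"] by (simp only: qmult_assoc)
  moreover have "imq u \<odot> a \<odot> imq v \<odot> imq v = - (imq u \<odot> a)"
    by (rule imq_square_right[OF assms(2)])
  ultimately show ?thesis
    by (simp add: intertwiner_def qmult.diff_left qmult.diff_right)
qed

text \<open>If every intertwiner vanished, \<open>a = 1\<close> would make \<open>imq v\<close>
  inverse to \<open>imq u\<close>, and \<open>imq u\<close> would then be central, hence real as
  well as pure. Every single \<open>a\<close> fails for some unit \<open>u\<close> and
  \<open>v\<close>, so it has to be chosen locally.\<close>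

lemma exists_intertwiner_nonzero:
  assumes "u \<noteq> 0"
  shows "\<exists>a. intertwiner a (u, v) \<noteq> 0"
proof (rule ccontr)
  assume "\<not> ?thesis"
  then have z: "intertwiner a (u, v) = 0" for a by blast
  have "u = 0"
    using z[of "vector [1,0,0,0]"] z[of "vector [0,1,0,0]"] z[of "vector [0,0,1,0]"]
      z[of "vector [0,0,0,1]"]
    by (auto simp: intertwiner_def imq_def qmult_def vec_eq_iff forall_4 forall_3)
  with assms show False by simp
qed

text \<open>Here \<open>imq u \<odot> x \<odot> qcnj x\<close> is already pure. Together with the
  next lemma this computes both vectors of the pair formed by an intertwiner \<open>h\<close> and
  \<open>imq u \<odot> h\<close>.\<close>

lemma lvec_imq_left: "lvec x (imq u \<odot> x) = (x \<bullet> x) *\<^sub>R u"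
  by (simp add: lvec_def vec_part_def imq_def qmult_def qcnj_def vec_eq_iff forall_3
      inner_vec_def sum_4 algebra_simps)

lemma rvec_imq_right: "rvec x (x \<odot> imq v) = (x \<bullet> x) *\<^sub>R v"
  by (simp add: rvec_def vec_part_def imq_def qmult_def qcnj_def vec_eq_iff forall_3
      inner_vec_def sum_4 algebra_simps)

lemma quotient_map_unit_vecs:
  "quotient_map (top_of_set lin_indep_pairs) (prod_topology (top_of_set S2) (top_of_set S2)) unit_vecs"
proof (rule quotient_map_local_sections)
  have "continuous_on lin_indep_pairs (\<lambda>z. (sgn (lvec (fst z) (snd z)), sgn (rvec (fst z) (snd z))))"
    using lvec_nonzero rvec_nonzero by (intro continuous_intros) auto
  then show "continuous_map (top_of_set lin_indep_pairs)
      (prod_topology (top_of_set S2) (top_of_set S2)) unit_vecs"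
    using lvec_nonzero rvec_nonzero
    by (auto simp: prod_topology_subtopology_eu unit_vecs_def case_prod_unfold norm_sgn)
next
  fix z assume "z \<in> topspace (prod_topology (top_of_set S2) (top_of_set S2))"
  then obtain u v where z: "z = (u, v)" "norm u = 1" "norm v = 1" by auto
  then have "u \<noteq> 0" by auto
  then obtain a where a: "intertwiner a z \<noteq> 0"
    unfolding z using exists_intertwiner_nonzero by blast
  define N where "N = {p \<in> S2 \<times> S2. intertwiner a p \<noteq> 0}"
  define s where "s = (\<lambda>p. (intertwiner a p, imq (fst p) \<odot> intertwiner a p))"
  have N: "openin (top_of_set (S2 \<times> S2)) N"
    using continuous_openin_preimage_gen[OF continuous_on_intertwiner, of "- {0}" "S2 \<times> S2" a]
    by (simp add: N_def vimage_def Int_def open_Compl)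
  have s: "unit_vecs (s p) = p \<and> s p \<in> lin_indep_pairs" if "p \<in> N" for p
  proof -
    obtain u v where p: "p = (u, v)" "norm u = 1" "norm v = 1" "intertwiner a (u, v) \<noteq> 0"
      using \<open>p \<in> N\<close> by (auto simp: N_def)
    let ?h = "intertwiner a (u, v)"
    have l: "lvec ?h (imq u \<odot> ?h) = (?h \<bullet> ?h) *\<^sub>R u"
      by (rule lvec_imq_left)
    \<comment> \<open>The intertwining relation rewrites \<open>imq u \<odot> ?h\<close> as
      \<open>?h \<odot> imq v\<close>, so \<open>v\<close> appears.\<close>
    have r: "rvec ?h (imq u \<odot> ?h) = (?h \<bullet> ?h) *\<^sub>R v"
      unfolding intertwiner_intertwines[OF p(2,3)] by (rule rvec_imq_right)
    \<comment> \<open>Positivity matters: \<open>sgn\<close> then returns \<open>u\<close> and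
      \<open>v\<close> themselves, with no change of sign.\<close>
    have "?h \<bullet> ?h > 0" using p(4) by simp
    then have "sgn ((?h \<bullet> ?h) *\<^sub>R u) = u" "sgn ((?h \<bullet> ?h) *\<^sub>R v) = v"
      using p by (simp_all add: sgn_div_norm sgn_scaleR)
    moreover have "s p \<in> lin_indep_pairs"
      unfolding s_def p fst_conv
      by (rule lin_indep_pairs_if_lvec_nonzero, unfold l) (use p in auto)
    ultimately show ?thesis by (simp add: s_def unit_vecs_def p(1) l r)
  qed
  have "continuous_on N s"
    unfolding s_def
    by (intro continuous_intros continuous_on_intertwiner qmult.continuous_on
        bounded_linear.continuous_on[OF bounded_linear_imq])
  moreover have "N \<subseteq> S2 \<times> S2" by (auto simp: N_def)
  ultimately show "\<exists>N s. openin (prod_topology (top_of_set S2) (top_of_set S2)) N \<and> z \<in> N \<and>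
      continuous_map (subtopology (prod_topology (top_of_set S2) (top_of_set S2)) N)
        (top_of_set lin_indep_pairs) s \<and> (\<forall>z\<in>N. unit_vecs (s z) = z)"
    using N s a z
    by (intro exI[of _ N] exI[of _ s])
      (auto simp: prod_topology_subtopology_eu subtopology_subtopology Int_absorb1 N_def)
qed

section \<open>Comparing the Grassmannian with \<open>P_space\<close>\<close>

lemma nu4_span_lvec: "(x, y) \<in> lin_indep_pairs \<Longrightarrow> nu4 (span {x, y}) = proj_class (lvec x y)"
  unfolding lvec_def by (rule nu4_span)

lemma quotient_map_span:
  "quotient_map (top_of_set lin_indep_pairs) Gr24 (\<lambda>(x, y). span {x, y})"
  unfolding Gr24_def by (rule quotient_map_quotient_topology)

lemma quotient_map_proj_class: "quotient_map (top_of_set (- {0})) RP2 proj_class"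
  unfolding RP2_def by (rule quotient_map_quotient_topology)

lemma proj_class_eq_iff:
  assumes "u \<noteq> 0" "w \<noteq> 0"
  shows "proj_class u = proj_class w \<longleftrightarrow> (\<exists>c. c \<noteq> 0 \<and> w = c *\<^sub>R u)"
  unfolding proj_class_def
  using eq_equiv_class_iff[OF equiv_scale_rel, of u w] assms by (auto simp: scale_rel_def)

text \<open>Normalising leaves only the sign of the common factor. Conversely, as
  \<open>lvec\<close> and \<open>rvec\<close> of a pair have the same norm, a common sign of the
  unit vectors gives one factor valid for both.\<close>

lemma span_eq_iff_unit_vecs:
  assumes "(x, y) \<in> lin_indep_pairs" "(x', y') \<in> lin_indep_pairs"
  shows "span {x, y} = span {x', y'} \<longleftrightarrow>
    unit_vecs (x', y') = unit_vecs (x, y) \<or> unit_vecs (x', y') = - unit_vecs (x, y)"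
proof
  assume "span {x, y} = span {x', y'}"
  then show "unit_vecs (x', y') = unit_vecs (x, y) \<or> unit_vecs (x', y') = - unit_vecs (x, y)"
    unfolding span_eq_iff_vecs[OF assms] by (auto simp: unit_vecs_def sgn_scaleR sgn_if)
next
  assume u: "unit_vecs (x', y') = unit_vecs (x, y) \<or> unit_vecs (x', y') = - unit_vecs (x, y)"
  have pos: "norm (lvec x y) > 0" "norm (lvec x' y') > 0"
    using assms lvec_nonzero by auto
  obtain e :: real where e: "e \<noteq> 0" "sgn (lvec x' y') = e *\<^sub>R sgn (lvec x y)"
    "sgn (rvec x' y') = e *\<^sub>R sgn (rvec x y)"
    using u that[of 1] that[of "-1"] by (auto simp: unit_vecs_def)
  have *: "w = (norm w * e / norm u) *\<^sub>R u" if "sgn w = e *\<^sub>R sgn u" for u w :: "real^3"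
  proof -
    have "w = norm w *\<^sub>R sgn w" by (cases "w = 0") (simp_all add: sgn_div_norm)
    also have "\<dots> = (norm w * e / norm u) *\<^sub>R u" unfolding that by (simp add: sgn_div_norm divide_inverse)
    finally show ?thesis .
  qed
  show "span {x, y} = span {x', y'}"
    unfolding span_eq_iff_vecs[OF assms]
    using *[OF e(2)] *[OF e(3)] pos e(1) unfolding norm_rvec
    by (intro exI[of _ "norm (lvec x' y') * e / norm (lvec x y)"]) auto
qed

text \<open>Both spaces are quotients of \<open>lin_indep_pairs\<close>, by the span and by the
  antipodal class of \<open>unit_vecs\<close>, with the same fibres. The formula on spans is kept
  for the comparison with \<open>nu4\<close>.\<close>

lemma homeomorphic_map_Gr24_P:
  obtains \<zeta> where "homeomorphic_map Gr24 P_space \<zeta>"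
    "\<And>x y. (x, y) \<in> lin_indep_pairs \<Longrightarrow> \<zeta> (span {x, y}) = antipodal_rel `` {unit_vecs (x, y)}"
proof -
  let ?r = "(\<lambda>z. antipodal_rel `` {z}) \<circ> unit_vecs"
  have q: "quotient_map (top_of_set lin_indep_pairs) P_space ?r"
    using quotient_map_unit_vecs unfolding P_space_def
    by (rule quotient_map_compose) (rule quotient_map_quotient_topology)
  have S: "unit_vecs z \<in> S2 \<times> S2" if "z \<in> lin_indep_pairs" for z
    using quotient_imp_surjective_map[OF quotient_map_unit_vecs] that by auto
  have fib: "(case z of (x, y) \<Rightarrow> span {x, y}) = (case z' of (x, y) \<Rightarrow> span {x, y}) \<longleftrightarrow> ?r z = ?r z'"
    if "z \<in> lin_indep_pairs" "z' \<in> lin_indep_pairs" for z z'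
  proof -
    obtain x y x' y' where z: "z = (x, y)" "z' = (x', y')" by fastforce
    have "?r z = ?r z' \<longleftrightarrow> (unit_vecs z, unit_vecs z') \<in> antipodal_rel"
      using eq_equiv_class_iff[OF equiv_antipodal_rel] S that by auto
    also have "\<dots> \<longleftrightarrow> unit_vecs z' = unit_vecs z \<or> unit_vecs z' = - unit_vecs z"
      using S[OF that(1)] by (cases "unit_vecs z"; cases "unit_vecs z'") (auto simp: antipodal_rel_def)
    finally show ?thesis
      using span_eq_iff_unit_vecs that by (simp add: z)
  qed
  obtain \<zeta> where "homeomorphic_map Gr24 P_space \<zeta>"
    "\<And>z. z \<in> topspace (top_of_set lin_indep_pairs) \<Longrightarrow> \<zeta> (case z of (x, y) \<Rightarrow> span {x, y}) = ?r z"
    by (rule homeomorphic_map_quotients[OF quotient_map_span q]) (use fib in auto)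
  then show ?thesis using that by force
qed

section \<open>Continuity and local triviality of \<open>nu4\<close>\<close>

lemma continuous_map_nu4: "continuous_map Gr24 RP2 nu4"
proof (rule continuous_compose_quotient_map[OF quotient_map_span])
  have "continuous_on lin_indep_pairs (\<lambda>z. lvec (fst z) (snd z))"
    by (intro continuous_intros)
  then have "continuous_map (top_of_set lin_indep_pairs) (top_of_set (- {0})) (\<lambda>z. lvec (fst z) (snd z))"
    using lvec_nonzero by auto
  from continuous_map_compose[OF this quotient_imp_continuous_map[OF quotient_map_proj_class]]
  show "continuous_map (top_of_set lin_indep_pairs) RP2 (nu4 \<circ> (\<lambda>(x, y). span {x, y}))"
    by (rule continuous_map_eq) (auto simp: nu4_span_lvec)
qed

text \<open>The set \<open>U\<close> is the affine chart of lines not orthogonal to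
  \<open>u0\<close>. The sign factor gives \<open>(u, v)\<close> and \<open>(- u, - v)\<close> the
  same image, so the map can serve as a trivialisation after passing to antipodal classes.\<close>

lemma quotient_map_line_times_S2:
  fixes u0 :: "real^3"
  defines "U \<equiv> proj_class ` {u. u \<bullet> u0 \<noteq> 0}"
  shows "openin RP2 U"
    "\<And>u. u \<noteq> 0 \<Longrightarrow> proj_class u \<in> U \<longleftrightarrow> u \<bullet> u0 \<noteq> 0"
    "quotient_map (top_of_set {z \<in> S2 \<times> S2. fst z \<bullet> u0 \<noteq> 0})
       (prod_topology (subtopology RP2 U) (top_of_set S2))
       (\<lambda>(u, v). (proj_class u, sgn (u \<bullet> u0) *\<^sub>R v))"
proof -
  show mem: "proj_class u \<in> U \<longleftrightarrow> u \<bullet> u0 \<noteq> 0" if "u \<noteq> 0" for u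
  proof
    assume "proj_class u \<in> U"
    then obtain w where w: "w \<bullet> u0 \<noteq> 0" "proj_class u = proj_class w" by (auto simp: U_def)
    then have "w \<noteq> 0" by auto
    then show "u \<bullet> u0 \<noteq> 0" using w proj_class_eq_iff that by auto
  qed (auto simp: U_def)
  have pre: "{u \<in> topspace (top_of_set (- {0})). proj_class u \<in> U} = {u. u \<bullet> u0 \<noteq> 0}"
  proof (rule set_eqI)
    show "u \<in> {u \<in> topspace (top_of_set (- {0})). proj_class u \<in> U} \<longleftrightarrow> u \<in> {u. u \<bullet> u0 \<noteq> 0}" for u
      using mem[of u] by (cases "u = 0") simp_all
  qed
  have "open {u. u \<bullet> u0 \<noteq> 0}"
    by (intro open_Collect_neq continuous_intros)
  moreover have V: "{u. u \<bullet> u0 \<noteq> 0} \<subseteq> - {0}" by auto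
  ultimately have "openin (top_of_set (- {0})) {u. u \<bullet> u0 \<noteq> 0}"
    by (simp add: open_subset)
  moreover have "U \<subseteq> proj_class ` (- {0})"
    unfolding U_def using V by (rule image_mono)
  ultimately show U: "openin RP2 U"
    unfolding RP2_def openin_quotient_topology pre by simp
  have q: "quotient_map (top_of_set {u. u \<bullet> u0 \<noteq> 0}) (subtopology RP2 U) proj_class"
    using quotient_map_restriction[OF quotient_map_proj_class pre] U
    by (simp add: subtopology_subtopology Int_absorb1[OF V])
  \<comment> \<open>This is the unit vector on the line of \<open>u\<close> on the positive side of
    \<open>u0\<close>. Replacing \<open>u\<close> by \<open>c *\<^sub>R u\<close> multiplies the
    argument of \<open>sgn\<close> by the square of \<open>c\<close>, so the choice descends to a
    continuous \<open>n\<close> on \<open>U\<close>.\<close>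
  let ?n = "\<lambda>u. sgn ((u \<bullet> u0) *\<^sub>R u)"
  have "continuous_on {u. u \<bullet> u0 \<noteq> 0} ?n"
    by (intro continuous_intros) auto
  moreover have "norm (?n u) = 1" "?n u \<bullet> u0 > 0" if "u \<bullet> u0 \<noteq> 0" for u
  proof -
    have "u \<noteq> 0" using that by auto
    then show "norm (?n u) = 1" using that by (simp add: norm_sgn)
    have "?n u \<bullet> u0 = \<bar>u \<bullet> u0\<bar> / norm u"
      using that by (simp add: sgn_scaleR) (simp add: sgn_div_norm divide_inverse abs_if)
    then show "?n u \<bullet> u0 > 0" using that \<open>u \<noteq> 0\<close> by simp
  qed
  ultimately have "continuous_map (top_of_set {u. u \<bullet> u0 \<noteq> 0}) (top_of_set {u \<in> S2. u \<bullet> u0 > 0}) ?n"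
    by auto
  moreover have "?n u = ?n w" if uw: "u \<bullet> u0 \<noteq> 0" "w \<bullet> u0 \<noteq> 0" "proj_class u = proj_class w" for u w
  proof -
    have "u \<noteq> 0" "w \<noteq> 0" using uw by auto
    then obtain c where "c \<noteq> 0" "w = c *\<^sub>R u"
      using proj_class_eq_iff uw(3) by blast
    then show ?thesis by (simp add: sgn_scaleR sgn_mult)
  qed
  ultimately obtain n where n_cont: "continuous_map (subtopology RP2 U) (top_of_set {u \<in> S2. u \<bullet> u0 > 0}) n"
    and n_eq: "\<And>u. u \<in> topspace (top_of_set {u. u \<bullet> u0 \<noteq> 0}) \<Longrightarrow> n (proj_class u) = ?n u"
    by (rule quotient_map_lift_exists[OF q, where h = ?n]) auto
  have proj_n: "proj_class (n l) = l" if l: "l \<in> U" for l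
  proof -
    obtain u where u: "u \<bullet> u0 \<noteq> 0" "l = proj_class u" using l by (auto simp: U_def)
    then have "u \<noteq> 0" by auto
    then show ?thesis using n_eq[of u] u
      by (simp add: sgn_div_norm proj_class_scaleR)
  qed
  let ?D = "{z \<in> S2 \<times> S2. fst z \<bullet> u0 \<noteq> 0}"
  let ?g = "\<lambda>(u, v). (proj_class u, sgn (u \<bullet> u0) *\<^sub>R v)"
  \<comment> \<open>A section over the whole product: \<open>n l\<close> lies on the positive side
    of \<open>u0\<close>, so the sign factor in \<open>?g\<close> is 1.\<close>
  let ?s = "\<lambda>(l, v). (n l, v)"
  show "quotient_map (top_of_set ?D) (prod_topology (subtopology RP2 U) (top_of_set S2)) ?g"
  proof (rule quotient_map_local_sections)
    have "continuous_map (top_of_set ?D) (top_of_set {u. u \<bullet> u0 \<noteq> 0}) fst"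
      by (auto intro!: continuous_intros)
    from continuous_map_compose[OF this quotient_imp_continuous_map[OF q]]
    have "continuous_map (top_of_set ?D) (subtopology RP2 U) (\<lambda>z. proj_class (fst z))"
      by (simp add: o_def)
    moreover have "continuous_on ?D (\<lambda>z. sgn (fst z \<bullet> u0) *\<^sub>R snd z)"
      by (intro continuous_intros) auto
    then have "continuous_map (top_of_set ?D) (top_of_set S2) (\<lambda>z. sgn (fst z \<bullet> u0) *\<^sub>R snd z)"
      by (auto simp: norm_sgn abs_sgn_eq)
    ultimately show "continuous_map (top_of_set ?D) (prod_topology (subtopology RP2 U) (top_of_set S2)) ?g"
      by (simp add: case_prod_unfold continuous_map_paired)
  next
    fix y assume y: "y \<in> topspace (prod_topology (subtopology RP2 U) (top_of_set S2))"
    let ?Y = "prod_topology (subtopology RP2 U) (top_of_set S2)"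
    have nl: "norm (n l) = 1 \<and> n l \<bullet> u0 > 0" if "l \<in> U" for l
      using n_cont that openin_subset[OF U] by (auto simp: continuous_map_in_subtopology)
    have "continuous_map ?Y (top_of_set {u \<in> S2. u \<bullet> u0 > 0}) (n \<circ> fst)"
      using n_cont by (intro continuous_map_compose[OF continuous_map_fst])
    then have "continuous_map ?Y (prod_topology (top_of_set {u \<in> S2. u \<bullet> u0 > 0}) (top_of_set S2)) ?s"
      by (simp add: case_prod_unfold continuous_map_paired continuous_map_snd o_def del: prod_topology_subtopology_eu)
    then have s: "continuous_map ?Y (top_of_set ?D) ?s"
      unfolding prod_topology_subtopology_eu
      by (auto simp: continuous_map_in_subtopology dest: nl)
    moreover have "?g (?s p) = p" if "p \<in> topspace ?Y" for p
      using that nl proj_n by auto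
    ultimately show "\<exists>N s. openin ?Y N \<and> y \<in> N \<and> continuous_map (subtopology ?Y N) (top_of_set ?D) s \<and>
        (\<forall>z\<in>N. ?g (s z) = z)"
      using y by (intro exI[of _ "topspace ?Y"] exI[of _ ?s]) (simp del: topspace_prod_topology)
  qed
qed

text \<open>The part of \<open>Gr24\<close> over a chart \<open>U\<close> and the product of
  \<open>U\<close> with the sphere are both quotients of the same set \<open>W\<close> of bases, by
  the span and by \<open>g \<circ> unit_vecs\<close>. Equal fibres yield the trivialisation.\<close>

lemma fibre_bundle_nu4: "fibre_bundle Gr24 RP2 (top_of_set S2) nu4"
  unfolding fibre_bundle_def
proof (intro conjI ballI continuous_map_nu4)
  fix b assume "b \<in> topspace RP2"
  then obtain u0 where u0: "u0 \<noteq> 0" "b = proj_class u0" by (auto simp: RP2_def)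
  \<comment> \<open>The chart contains \<open>b\<close>, since \<open>u0\<close> is not orthogonal
    to itself.\<close>
  define U where "U = proj_class ` {u. u \<bullet> u0 \<noteq> 0}"
  define W where "W = {z \<in> lin_indep_pairs. lvec (fst z) (snd z) \<bullet> u0 \<noteq> 0}"
  define D where "D = {z \<in> S2 \<times> S2. fst z \<bullet> u0 \<noteq> (0::real)}"
  define g where "g = (\<lambda>(u, v::real^3). (proj_class u, sgn (u \<bullet> u0) *\<^sub>R v))"
  let ?B = "prod_topology (subtopology RP2 U) (top_of_set S2)"
  let ?V = "{V \<in> topspace Gr24. nu4 V \<in> U}"
  note U = quotient_map_line_times_S2[where ?u0.0 = u0, folded U_def D_def, folded g_def]
  have W: "subtopology (top_of_set lin_indep_pairs) W = top_of_set W"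
    by (simp add: subtopology_subtopology W_def Int_absorb1)
  \<comment> \<open>Restricting a quotient map to the full preimage of an open set keeps it a
    quotient map; \<open>W\<close> is such a preimage both for the span and for
    \<open>unit_vecs\<close>.\<close>
  have "quotient_map (subtopology (top_of_set lin_indep_pairs) W) (subtopology Gr24 ?V) (\<lambda>(x, y). span {x, y})"
  proof (rule quotient_map_restriction[OF quotient_map_span])
    show "{x \<in> topspace (top_of_set lin_indep_pairs). (case x of (x, y) \<Rightarrow> span {x, y}) \<in> ?V} = W"
      using U(2) lvec_nonzero by (auto simp: W_def nu4_span_lvec Gr24_def)
    show "openin Gr24 ?V \<or> closedin Gr24 ?V"
      using openin_continuous_map_preimage[OF continuous_map_nu4 U(1)] by blast
  qed
  then have qG: "quotient_map (top_of_set W) (subtopology Gr24 ?V) (\<lambda>(x, y). span {x, y})"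
    by (simp add: W)
  have "quotient_map (subtopology (top_of_set lin_indep_pairs) W)
      (subtopology (prod_topology (top_of_set S2) (top_of_set S2)) D) unit_vecs"
  proof (rule quotient_map_restriction[OF quotient_map_unit_vecs])
    show "{z \<in> topspace (top_of_set lin_indep_pairs). unit_vecs z \<in> D} = W"
      using lvec_nonzero rvec_nonzero
      by (auto simp: D_def W_def unit_vecs_def norm_sgn) (auto simp: sgn_div_norm)
    have "open {z::(real^3)\<times>(real^3). fst z \<bullet> u0 \<noteq> 0}"
      by (intro open_Collect_neq continuous_intros)
    then show "openin (prod_topology (top_of_set S2) (top_of_set S2)) D \<or>
        closedin (prod_topology (top_of_set S2) (top_of_set S2)) D"
      by (auto simp: prod_topology_subtopology_eu D_def openin_subtopology Int_def)
  qed
  then have "quotient_map (top_of_set W) (top_of_set D) unit_vecs"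
    unfolding W prod_topology_subtopology_eu subtopology_subtopology
    using Int_absorb1[of D "S2 \<times> S2"] Int_absorb1[of W lin_indep_pairs] by (auto simp: D_def W_def)
  then have qB: "quotient_map (top_of_set W) ?B (g \<circ> unit_vecs)"
    using U(3) by (rule quotient_map_compose)
  have fib: "(case z of (x, y) \<Rightarrow> span {x, y}) = (case z' of (x, y) \<Rightarrow> span {x, y}) \<longleftrightarrow>
      (g \<circ> unit_vecs) z = (g \<circ> unit_vecs) z'" if zW: "z \<in> W" "z' \<in> W" for z z'
  proof -
    obtain x y x' y' where z: "z = (x, y)" "z' = (x', y')" by fastforce
    have li: "(x, y) \<in> lin_indep_pairs" "(x', y') \<in> lin_indep_pairs"
      using zW z by (auto simp: W_def)
    obtain u v u' v' where uv: "unit_vecs z = (u, v)" "unit_vecs z' = (u', v')" by fastforce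
    have S: "(u, v) \<in> D" "(u', v') \<in> D"
      using quotient_imp_surjective_map[OF \<open>quotient_map (top_of_set W) (top_of_set D) unit_vecs\<close>] zW uv
      by auto (metis image_eqI)+
    then have n: "norm u = 1" "norm u' = 1" "u \<bullet> u0 \<noteq> 0" "u' \<bullet> u0 \<noteq> 0" by (auto simp: D_def)
    then have nz: "u \<noteq> 0" "u' \<noteq> 0" by auto
    \<comment> \<open>Unit vectors on the same line differ by a sign, and the factor
      \<open>sgn (u \<bullet> u0)\<close> forces the same sign between \<open>v\<close> and
      \<open>v'\<close>.\<close>
    have "g (u, v) = g (u', v') \<longleftrightarrow> (u', v') = (u, v) \<or> (u', v') = - (u, v)"
    proof
      assume e: "g (u, v) = g (u', v')"
      then obtain c where c: "u' = c *\<^sub>R u" using proj_class_eq_iff[OF nz] by (auto simp: g_def)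
      then have "\<bar>c\<bar> = 1" using n by simp
      then have "c = 1 \<or> c = -1" by linarith
      then show "(u', v') = (u, v) \<or> (u', v') = - (u, v)"
        using c e n(3) by (auto simp: g_def sgn_if split: if_splits)
    next
      assume "(u', v') = (u, v) \<or> (u', v') = - (u, v)"
      then show "g (u, v) = g (u', v')"
        using proj_class_scaleR[of "-1" u] n(3) by (auto simp: g_def sgn_if)
    qed
    then show ?thesis
      using span_eq_iff_unit_vecs[OF li] uv by (simp add: z)
  qed
  obtain \<phi> where \<phi>: "homeomorphic_map (subtopology Gr24 ?V) ?B \<phi>"
    "\<And>z. z \<in> topspace (top_of_set W) \<Longrightarrow> \<phi> (case z of (x, y) \<Rightarrow> span {x, y}) = (g \<circ> unit_vecs) z"
    by (rule homeomorphic_map_quotients[OF qG qB]) (use fib in auto)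
  have "fst (\<phi> V) = nu4 V" if V: "V \<in> topspace Gr24" "nu4 V \<in> U" for V
  proof -
    have "V \<in> (\<lambda>(x, y). span {x, y}) ` W"
      using quotient_imp_surjective_map[OF qG] V by auto
    then obtain x y where xy: "(x, y) \<in> W" "V = span {x, y}" by auto
    then have li: "(x, y) \<in> lin_indep_pairs" by (simp add: W_def)
    have "fst (\<phi> V) = proj_class (sgn (lvec x y))"
      using \<phi>(2)[of "(x, y)"] xy by (simp add: g_def unit_vecs_def)
    then show ?thesis
      using lvec_nonzero[OF li] by (simp add: xy(2) nu4_span_lvec[OF li] sgn_div_norm proj_class_scaleR)
  qed
  moreover have "b \<in> U" using u0 by (auto simp: U_def)
  ultimately show "\<exists>U \<phi>. openin RP2 U \<and> b \<in> U \<and>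
      homeomorphic_map (subtopology Gr24 {e \<in> topspace Gr24. nu4 e \<in> U})
        (prod_topology (subtopology RP2 U) (top_of_set S2)) \<phi> \<and>
      (\<forall>e\<in>topspace Gr24. nu4 e \<in> U \<longrightarrow> fst (\<phi> e) = nu4 e)"
    using U(1) \<phi>(1) by blast
qed

theorem proposition2p3:
  shows "(\<exists>\<zeta>. homeomorphic_map Gr24 P_space \<zeta> \<and>
              (\<forall>V \<in> topspace Gr24. P_proj (\<zeta> V) = nu4 V)) \<and>
         fibre_bundle Gr24 RP2 (top_of_set S2) nu4"
proof
  obtain \<zeta> where \<zeta>: "homeomorphic_map Gr24 P_space \<zeta>"
    "\<And>x y. (x, y) \<in> lin_indep_pairs \<Longrightarrow> \<zeta> (span {x, y}) = antipodal_rel `` {unit_vecs (x, y)}"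
    using homeomorphic_map_Gr24_P by blast
  have "P_proj (\<zeta> V) = nu4 V" if V: "V \<in> topspace Gr24" for V
  proof -
    obtain x y where xy: "(x, y) \<in> lin_indep_pairs" "V = span {x, y}"
      using V by (auto simp: Gr24_def)
    \<comment> \<open>Normalising \<open>lvec x y\<close> does not change its line, which is
      \<open>nu4 V\<close>.\<close>
    have "P_proj (\<zeta> V) = proj_class (sgn (lvec x y))"
      unfolding xy(2) \<zeta>(2)[OF xy(1)] unit_vecs_def prod.case
      using lvec_nonzero[OF xy(1)] rvec_nonzero[OF xy(1)] by (intro P_proj_class) (auto simp: norm_sgn)
    then show ?thesis
      using lvec_nonzero[OF xy(1)]
      by (simp add: xy(2) nu4_span_lvec[OF xy(1)] sgn_div_norm proj_class_scaleR)
  qed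
  then show "\<exists>\<zeta>. homeomorphic_map Gr24 P_space \<zeta> \<and> (\<forall>V \<in> topspace Gr24. P_proj (\<zeta> V) = nu4 V)"
    using \<zeta>(1) by blast
qed (rule fibre_bundle_nu4)

end
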